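(* Let $X\in\mathbb{R}^{m\times n}$ and $Y\in\mathbb{R}^{k\times n}$, let $\mathcal{M}\subset\mathbb{R}^{k\times m\times m}$ be the manifold of nonzero tensors of the form $w\circ u_2\circ u_3$ with $w\in\mathbb{R}^k$, $u_2,u_3\in\mathbb{R}^m$, and let $F_0(\mathcal{W})=\tfrac12\|\mathcal{W}X-Y\|_F^2$. (1) If $\mathcal{W}=(U_1c)\circ u\circ u\in\mathcal{M}$, with $U_1\in\mathbb{R}^{k\times k}$ orthogonal, $c\in\mathbb{R}^k$ and $u\in\mathbb{R}^m$, $\|u\|_2=1$, is a stationary point of $F_0$ subject to $\mathcal{W}\in\mathcal{M}$, then there exists $\gamma\in\mathbb{R}$ such that $(\gamma,u)$ is a B-eigenpair of the tensor pencil $(\mathcal{Z}_{XX},\mathcal{Z}_{XY})$, i.e. $\mathcal{Z}_{XX}u=\gamma\,\mathcal{Z}_{XY}u$ (and $u^{T}u=1$). (2) Conversely, if $(\gamma,u)$ is a B-eigenpair of $(\mathcal{Z}_{XX},\mathcal{Z}_{XY})$ for some $\gamma\in\mathbb{R}$, then there exist an orthogonal $U_1\in\mathbb{R}^{k\times k}$ and $c\in\mathbb{R}^k$ such that $\mathcal{W}=(U_1c)\circ u\circ u$ lies in $\mathcal{M}$ and is a stationary point of $F_0$ subject to $\mathcal{W}\in\mathcal{M}$.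
   Context: $\circ$ denotes the outer product: $(w\circ u\circ v)_{jab}=w_ju_av_b$. Apply operation: for $\mathcal{A}\in\mathbb{R}^{k\times m\times\cdots\times m}$ of order $d+1$ and $x\in\mathbb{R}^m$, $\mathcal{A}x\in\mathbb{R}^k$ is $(\mathcal{A}x)_j=\sum_{i_2,\dots,i_{d+1}=1}^m \mathcal{A}_{j i_2\cdots i_{d+1}}x_{i_2}\cdots x_{i_{d+1}}$; for a matrix $X$ with columns $x_1,\dots,x_n$, $\mathcal{A}X$ is the matrix with columns $\mathcal{A}x_1,\dots,\mathcal{A}x_n$. $\mathcal{M}$ is regarded as a Riemannian submanifold of $\mathbb{R}^{k\times m\times m}$ with the standard inner product. A stationary point is a $\mathcal{W}\in\mathcal{M}$ at which the Riemannian gradient vanishes, i.e. the orthogonal projection of the Euclidean gradient $\nabla F_0(\mathcal{W})$ onto the tangent space $T_{\mathcal{W}}\mathcal{M}$ is zero. The tensors $\mathcal{Z}_{XX},\mathcal{Z}_{XY}\in\mathbb{R}^{m\times m\times m\times m}$ are $$(\mathcal{Z}_{XX})_{abcd}=\sum_{i=1}^n X_{ai}X_{bi}X_{ci}X_{di},\qquad (\mathcal{Z}_{XY})_{abcd}=\sum_{l=1}^k T_{lab}T_{lcd},\quad T_{lab}=\sum_{i=1}^n Y_{li}X_{ai}X_{bi}.$$ A pair $(\gamma,u)\in\mathbb{R}\times\mathbb{R}^m$ is a B-eigenpair of $(\mathcal{Z}_{XX},\mathcal{Z}_{XY})$ if $\mathcal{Z}_{XX}u=\gamma\,\mathcal{Z}_{XY}u$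 and $u^{T}u=1$. *)

theory Defs
  imports "HOL-Analysis.Analysis"
begin

text \<open>
  A tensor of size \<open>k \<times> m \<times> m\<close> has type \<open>real ^ 'm ^ 'm ^ 'k\<close>, with entries
  \<open>W $ j $ a $ b\<close> (the outermost type index is the first tensor index), and similarly for order
  four. The library inner product and norm on these nested types are the entrywise ones; in
  particular \<open>norm\<close> of a matrix is its Frobenius norm.
\<close>

definition outer3 :: "real ^ 'p \<Rightarrow> real ^ 'q \<Rightarrow> real ^ 'r \<Rightarrow> real ^ 'r ^ 'q ^ 'p" where
  "outer3 w u v = (\<chi> j a b. w $ j * u $ a * v $ b)"

definition tensor3_apply :: "real ^ 'm ^ 'm ^ 'k \<Rightarrow> real ^ 'm \<Rightarrow> real ^ 'k" where
  "tensor3_apply A x = (\<chi> j. \<Sum>a\<in>UNIV. \<Sum>b\<in>UNIV. A $ j $ a $ b * x $ a * x $ b)"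

definition tensor4_apply :: "real ^ 'm ^ 'm ^ 'm ^ 'k \<Rightarrow> real ^ 'm \<Rightarrow> real ^ 'k" where
  "tensor4_apply A x =
    (\<chi> j. \<Sum>a\<in>UNIV. \<Sum>b\<in>UNIV. \<Sum>c\<in>UNIV. A $ j $ a $ b $ c * x $ a * x $ b * x $ c)"

definition tensor3_apply_matrix :: "real ^ 'm ^ 'm ^ 'k \<Rightarrow> real ^ 'n ^ 'm \<Rightarrow> real ^ 'n ^ 'k" where
  "tensor3_apply_matrix A X = (\<chi> j i. tensor3_apply A (column i X) $ j)"

definition rank_one_tensors :: "(real ^ 'm ^ 'm ^ 'k) set" where
  "rank_one_tensors = {W. W \<noteq> 0 \<and> (\<exists>w u\<^sub>2 u\<^sub>3. W = outer3 w u\<^sub>2 u\<^sub>3)}"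

definition F0 :: "real ^ 'n ^ 'm \<Rightarrow> real ^ 'n ^ 'k \<Rightarrow> real ^ 'm ^ 'm ^ 'k \<Rightarrow> real" where
  "F0 X Y W = 1 / 2 * (norm (tensor3_apply_matrix W X - Y))\<^sup>2"

text \<open>Infinitely differentiable on \<open>S\<close> (meant for open \<open>S\<close>): \<open>D n\<close> is the \<open>n\<close>-th derivative.\<close>

definition smooth_curve_on :: "real set \<Rightarrow> (real \<Rightarrow> 'a::real_normed_vector) \<Rightarrow> bool" where
  "smooth_curve_on S c \<longleftrightarrow>
    (\<exists>D :: nat \<Rightarrow> real \<Rightarrow> 'a. D 0 = c \<and>
      (\<forall>n. \<forall>t\<in>S. (D n has_vector_derivative D (Suc n) t) (at t)))"

text \<open>The tangent space of an embedded submanifold: velocities of smooth curves in \<open>M\<close>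
  through \<open>p\<close>.\<close>

definition tangent_space :: "'a::real_normed_vector set \<Rightarrow> 'a \<Rightarrow> 'a set" where
  "tangent_space M p =
    {V. \<exists>c e. e > 0 \<and> smooth_curve_on {-e<..<e} c \<and> c ` {-e<..<e} \<subseteq> M \<and> c 0 = p \<and>
          (c has_vector_derivative V) (at 0)}"

definition is_orthogonal_projection :: "'a::real_inner set \<Rightarrow> 'a \<Rightarrow> 'a \<Rightarrow> bool" where
  "is_orthogonal_projection S x y \<longleftrightarrow> y \<in> S \<and> (\<forall>v\<in>S. orthogonal (x - y) v)"

definition has_riemannian_gradient ::
  "'a::real_inner set \<Rightarrow> ('a \<Rightarrow> real) \<Rightarrow> 'a \<Rightarrow> 'a \<Rightarrow> bool" where
  "has_riemannian_gradient M f p g \<longleftrightarrow>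
    (\<exists>G. GDERIV f p :> G \<and> is_orthogonal_projection (tangent_space M p) G g)"

definition is_stationary_point :: "'a::real_inner set \<Rightarrow> ('a \<Rightarrow> real) \<Rightarrow> 'a \<Rightarrow> bool" where
  "is_stationary_point M f p \<longleftrightarrow> p \<in> M \<and> has_riemannian_gradient M f p 0"

definition Z_XX :: "real ^ 'n ^ 'm \<Rightarrow> real ^ 'm ^ 'm ^ 'm ^ 'm" where
  "Z_XX X = (\<chi> a b c d. \<Sum>i\<in>UNIV. X $ a $ i * X $ b $ i * X $ c $ i * X $ d $ i)"

definition T_XY :: "real ^ 'n ^ 'm \<Rightarrow> real ^ 'n ^ 'k \<Rightarrow> real ^ 'm ^ 'm ^ 'k" where
  "T_XY X Y = (\<chi> l a b. \<Sum>i\<in>UNIV. Y $ l $ i * X $ a $ i * X $ b $ i)"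

definition Z_XY :: "real ^ 'n ^ 'm \<Rightarrow> real ^ 'n ^ 'k \<Rightarrow> real ^ 'm ^ 'm ^ 'm ^ 'm" where
  "Z_XY X Y = (\<chi> a b c d. \<Sum>l\<in>UNIV. T_XY X Y $ l $ a $ b * T_XY X Y $ l $ c $ d)"

definition is_B_eigenpair ::
  "real ^ 'm ^ 'm ^ 'm ^ 'm \<Rightarrow> real ^ 'm ^ 'm ^ 'm ^ 'm \<Rightarrow> real \<Rightarrow> real ^ 'm \<Rightarrow> bool" where
  "is_B_eigenpair A B \<gamma> u \<longleftrightarrow>
    tensor4_apply A u = \<gamma> *\<^sub>R tensor4_apply B u \<and> u \<bullet> u = 1"

end

theory Submission
  imports Defs
begin

text \<open>
  The Euclidean gradient at \<open>w \<circ> u \<circ> u\<close> is \<open>\<Sum>i. r\<^sub>i \<circ> x\<^sub>i \<circ> x\<^sub>i\<close>, where \<open>r\<^sub>i = (x\<^sub>i \<bullet> u)\<^sup>2 w - y\<^sub>i\<close>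
  is the residual of the \<open>i\<close>-th sample. The tangent space at \<open>w \<circ> u \<circ> u\<close> is spanned by the tensors
  \<open>v \<circ> u \<circ> u\<close>, \<open>w \<circ> v \<circ> u\<close> and \<open>w \<circ> u \<circ> v\<close>, so stationarity means
  \<open>\<Sum>i. (x\<^sub>i \<bullet> u)\<^sup>2 r\<^sub>i = 0\<close> and \<open>\<Sum>i. (w \<bullet> r\<^sub>i) (x\<^sub>i \<bullet> u) x\<^sub>i = 0\<close>. With \<open>\<sigma> = \<Sum>i. (x\<^sub>i \<bullet> u)\<^sup>4\<close> and
  \<open>t = \<Sum>i. (x\<^sub>i \<bullet> u)\<^sup>2 y\<^sub>i\<close> the first equation is \<open>\<sigma> w = t\<close>, and then \<open>\<sigma>\<close> times the second one reads
  \<open>\<sigma> \<parallel>w\<parallel>\<^sup>2 Z_XX u = Z_XY u\<close>. If \<open>\<sigma> = 0\<close>, then all \<open>x\<^sub>i \<bullet> u\<close> vanish and everything is zero.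
\<close>

section \<open>Algebra of outer products\<close>

lemma outer3_add1: "outer3 (a + a') b c = outer3 a b c + outer3 a' b c"
  and outer3_add2: "outer3 a (b + b') c = outer3 a b c + outer3 a b' c"
  and outer3_add3: "outer3 a b (c + c') = outer3 a b c + outer3 a b c'"
  by (simp_all add: outer3_def vec_eq_iff algebra_simps)

lemma outer3_scale1: "outer3 (r *\<^sub>R a) b c = r *\<^sub>R outer3 a b c"
  and outer3_scale2: "outer3 a (r *\<^sub>R b) c = r *\<^sub>R outer3 a b c"
  and outer3_scale3: "outer3 a b (r *\<^sub>R c) = r *\<^sub>R outer3 a b c"
  by (simp_all add: outer3_def vec_eq_iff algebra_simps)

lemma linear_outer3_1: "linear (\<lambda>a. outer3 a b c)"
  and linear_outer3_2: "linear (\<lambda>b. outer3 a b c)"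
  and linear_outer3_3: "linear (\<lambda>c. outer3 a b c)"
  by (auto intro!: linearI simp: outer3_add1 outer3_add2 outer3_add3
      outer3_scale1 outer3_scale2 outer3_scale3)

lemma inner_outer3:
  "W \<bullet> outer3 a b c = (\<Sum>j\<in>UNIV. \<Sum>p\<in>UNIV. \<Sum>q\<in>UNIV. W $ j $ p $ q * (a $ j * b $ p * c $ q))"
  by (simp add: inner_vec_def outer3_def)

lemma inner_outer3_outer3:
  "outer3 a b c \<bullet> outer3 a' b' c' = (a \<bullet> a') * (b \<bullet> b') * (c \<bullet> c')"
proof -
  have "outer3 a b c \<bullet> outer3 a' b' c'
      = (\<Sum>j\<in>UNIV. \<Sum>p\<in>UNIV. \<Sum>q\<in>UNIV. (a $ j * a' $ j) * ((b $ p * b' $ p) * (c $ q * c' $ q)))"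
    by (simp add: inner_outer3, simp add: outer3_def mult_ac)
  also have "\<dots> = (a \<bullet> a') * ((b \<bullet> b') * (c \<bullet> c'))"
    by (simp add: inner_vec_def sum_distrib_left[symmetric] sum_distrib_right[symmetric])
  finally show ?thesis by simp
qed

text \<open>The squared norm of an outer product is the product of the squared norms of its
  factors.\<close>

lemma outer3_eq_0_iff: "outer3 a b c = 0 \<longleftrightarrow> a = 0 \<or> b = 0 \<or> c = 0"
  using inner_eq_zero_iff[of "outer3 a b c"] by (simp add: inner_outer3_outer3)

section \<open>The Euclidean gradient of the least squares objective\<close>

lemma linear_tensor3_apply_matrix: "linear (\<lambda>W. tensor3_apply_matrix W X)"
  by (rule linearI) (simp_all add: tensor3_apply_matrix_def tensor3_apply_def vec_eq_iff
      algebra_simps sum.distrib sum_distrib_left)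

lemma column_tensor3_apply_matrix_outer3:
  "column i (tensor3_apply_matrix (outer3 w u u) X) = (column i X \<bullet> u)\<^sup>2 *\<^sub>R w"
proof -
  have "(\<Sum>a\<in>UNIV. \<Sum>b\<in>UNIV. w $ j * u $ a * u $ b * X $ a $ i * X $ b $ i)
      = w $ j * (column i X \<bullet> u)\<^sup>2" for j
  proof -
    have "(\<Sum>a\<in>UNIV. \<Sum>b\<in>UNIV. w $ j * u $ a * u $ b * X $ a $ i * X $ b $ i)
      = (\<Sum>a\<in>UNIV. \<Sum>b\<in>UNIV. w $ j * ((X $ a $ i * u $ a) * (X $ b $ i * u $ b)))"
      by (simp add: mult_ac)
    also have "\<dots> = w $ j * ((\<Sum>a\<in>UNIV. X $ a $ i * u $ a) * (\<Sum>b\<in>UNIV. X $ b $ i * u $ b))"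
      by (simp only: sum_product) (simp add: sum_distrib_left)
    finally show ?thesis by (simp add: inner_vec_def column_def power2_eq_square)
  qed
  then show ?thesis
    by (simp add: vec_eq_iff column_def tensor3_apply_matrix_def tensor3_apply_def outer3_def)
qed

text \<open>The adjoint of the linear map from \<open>W\<close> to
  \<open>tensor3_apply_matrix W X\<close>; with the residual as \<open>R\<close> it turns the
  derivative of \<open>F0\<close> into a gradient.\<close>

lemma inner_tensor3_apply_matrix:
  "R \<bullet> tensor3_apply_matrix W X = (\<Sum>i\<in>UNIV. outer3 (column i R) (column i X) (column i X) \<bullet> W)"
proof -
  have "R \<bullet> tensor3_apply_matrix W X
      = (\<Sum>j\<in>UNIV. \<Sum>i\<in>UNIV. \<Sum>a\<in>UNIV. \<Sum>b\<in>UNIV. R $ j $ i * X $ a $ i * X $ b $ i * W $ j $ a $ b)"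
    by (simp add: inner_vec_def tensor3_apply_matrix_def tensor3_apply_def column_def
        sum_distrib_left mult_ac)
  also have "\<dots>
      = (\<Sum>i\<in>UNIV. \<Sum>j\<in>UNIV. \<Sum>a\<in>UNIV. \<Sum>b\<in>UNIV. R $ j $ i * X $ a $ i * X $ b $ i * W $ j $ a $ b)"
    by (rule sum.swap)
  finally show ?thesis
    by (simp add: inner_vec_def outer3_def column_def)
qed

lemma GDERIV_F0:
  "GDERIV (F0 X Y) W :>
    (\<Sum>i\<in>UNIV. outer3 (column i (tensor3_apply_matrix W X - Y)) (column i X) (column i X))"
proof -
  define R where "R = tensor3_apply_matrix W X - Y"
  have F0: "F0 X Y = (\<lambda>W. 1 / 2 * ((tensor3_apply_matrix W X - Y) \<bullet> (tensor3_apply_matrix W X - Y)))"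
    by (simp add: F0_def fun_eq_iff power2_norm_eq_inner)
  have [derivative_intros]:
    "((\<lambda>W. tensor3_apply_matrix W X) has_derivative (\<lambda>V. tensor3_apply_matrix V X)) (at W)"
    by (rule linear_imp_has_derivative[OF linear_tensor3_apply_matrix])
  have "(F0 X Y has_derivative (\<lambda>V. R \<bullet> tensor3_apply_matrix V X)) (at W)"
    unfolding F0 by (auto intro!: derivative_eq_intros simp: R_def inner_commute)
  then show ?thesis
    unfolding gderiv_def R_def[symmetric]
    by (simp add: inner_tensor3_apply_matrix inner_sum_left inner_sum_right inner_commute)
qed

section \<open>Tangent vectors to the rank one tensors\<close>

lemma line_mem_tangent_space:
  assumes "e > 0" and "\<And>t. \<bar>t\<bar> < e \<Longrightarrow> p + t *\<^sub>R V \<in> M"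
  shows "V \<in> tangent_space M p"
proof -
  \<comment> \<open>The successive derivatives of an affine curve: the curve itself, its velocity,
    then zero.\<close>
  define D where "D n t = (if n = 0 then p + t *\<^sub>R V else if n = 1 then V else 0)" for n :: nat and t :: real
  have d: "((\<lambda>t. p + t *\<^sub>R V) has_vector_derivative V) (at t)" for t :: real
    by (auto intro!: derivative_eq_intros)
  have "(D n has_vector_derivative D (Suc n) t) (at t)" for n t
    using d[of t] by (cases n) (simp_all add: D_def[abs_def])
  moreover have "D 0 = (\<lambda>t. p + t *\<^sub>R V)"
    by (simp add: D_def fun_eq_iff)
  ultimately have "smooth_curve_on {-e<..<e} (\<lambda>t. p + t *\<^sub>R V)"
    unfolding smooth_curve_on_def by blast
  moreover have "(\<lambda>t. p + t *\<^sub>R V) ` {-e<..<e} \<subseteq> M"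
    using assms(2) by auto
  ultimately show ?thesis
    unfolding tangent_space_def using assms(1) d[of 0]
    by (intro CollectI exI[of _ "\<lambda>t. p + t *\<^sub>R V"] exI[of _ e]) auto
qed

text \<open>Only nonvanishing restricts \<open>t\<close>: a short enough step along \<open>V\<close>
  cannot cancel the nonzero \<open>p\<close>.\<close>

lemma mem_tangent_space_rank_one_tensors:
  assumes "p \<in> rank_one_tensors" and "\<And>t. \<exists>a b c. p + t *\<^sub>R V = outer3 a b c"
  shows "V \<in> tangent_space rank_one_tensors p"
proof (rule line_mem_tangent_space[of "norm p / (norm V + 1)"])
  have p: "p \<noteq> 0" using assms(1) by (simp add: rank_one_tensors_def)
  \<comment> \<open>The summand 1 keeps the radius positive when \<open>V\<close> is zero.\<close>
  have V: "norm V + 1 > 0" by (simp add: add_nonneg_pos)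
  show "norm p / (norm V + 1) > 0" using p V by simp
  fix t :: real assume "\<bar>t\<bar> < norm p / (norm V + 1)"
  then have "\<bar>t\<bar> * norm V + \<bar>t\<bar> < norm p"
    using V by (simp add: pos_less_divide_eq algebra_simps)
  then have "norm (t *\<^sub>R V) < norm p" by simp
  then have "p + t *\<^sub>R V \<noteq> 0"
    by (metis add_eq_0_iff2 norm_minus_cancel less_irrefl)
  then show "p + t *\<^sub>R V \<in> rank_one_tensors"
    using assms(2)[of t] by (auto simp: rank_one_tensors_def)
qed

text \<open>
  This says that \<open>V\<close> lies in the span of the three obvious families of tangent vectors. It comes from
  differentiating the cubic identity
  \<open>\<langle>W, w \<circ> u \<circ> u\<rangle>\<^sup>2 W = W(\<cdot>, u, u) \<circ> W(w, \<cdot>, u) \<circ> W(w, u, \<cdot>)\<close>, valid for all \<open>W\<close> of rank one; this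
  avoids lifting a curve of rank one tensors to curves of its factors.
\<close>

lemma inner_outer3_tangent_space:
  assumes V: "V \<in> tangent_space rank_one_tensors (outer3 w u u)" and u: "u \<bullet> u = 1"
  shows "(w \<bullet> w)\<^sup>2 * (V \<bullet> outer3 x y z)
       = (w \<bullet> w)\<^sup>2 * (V \<bullet> outer3 x u u) * (u \<bullet> y) * (u \<bullet> z)
       + (w \<bullet> w) * (w \<bullet> x) * (V \<bullet> outer3 w y u) * (u \<bullet> z)
       + (w \<bullet> w) * (w \<bullet> x) * (u \<bullet> y) * (V \<bullet> outer3 w u z)
       - 2 * (w \<bullet> w) * (V \<bullet> outer3 w u u) * (w \<bullet> x) * (u \<bullet> y) * (u \<bullet> z)"
proof -
  obtain c e where e: "e > 0" and cM: "c ` {-e<..<e} \<subseteq> rank_one_tensors"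
    and c0: "c 0 = outer3 w u u" and c': "(c has_vector_derivative V) (at 0)"
    using V by (auto simp: tangent_space_def)
  have [derivative_intros]: "((\<lambda>t. c t \<bullet> Q) has_real_derivative V \<bullet> Q) (at 0)" for Q
    using bounded_linear.has_vector_derivative[OF bounded_linear_inner_left c']
    by (simp add: has_real_derivative_iff_has_vector_derivative)
  \<comment> \<open>The two sides of the cubic identity, paired with \<open>outer3 x y z\<close>. On
    an outer product both become products of the same nine inner products.\<close>
  let ?f = "\<lambda>t. (c t \<bullet> outer3 w u u)\<^sup>2 * (c t \<bullet> outer3 x y z)"
  let ?g = "\<lambda>t. (c t \<bullet> outer3 x u u) * (c t \<bullet> outer3 w y u) * (c t \<bullet> outer3 w u z)"
  have fg: "?f t = ?g t" if "t \<in> {-e<..<e}" for t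
  proof -
    obtain a b d where "c t = outer3 a b d"
      using cM \<open>t \<in> _\<close> by (fastforce simp: rank_one_tensors_def)
    then show ?thesis by (simp add: inner_outer3_outer3 power2_eq_square)
  qed
  have f': "(?f has_real_derivative
      (w \<bullet> w)\<^sup>2 * (V \<bullet> outer3 x y z)
      + 2 * (w \<bullet> w) * (V \<bullet> outer3 w u u) * ((w \<bullet> x) * (u \<bullet> y) * (u \<bullet> z))) (at 0)"
    by (auto intro!: derivative_eq_intros simp: c0 inner_outer3_outer3 u)
  have g': "(?g has_real_derivative
      (V \<bullet> outer3 x u u) * ((w \<bullet> w) * (u \<bullet> y)) * ((w \<bullet> w) * (u \<bullet> z))
      + (w \<bullet> x) * (V \<bullet> outer3 w y u) * ((w \<bullet> w) * (u \<bullet> z))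
      + (w \<bullet> x) * ((w \<bullet> w) * (u \<bullet> y)) * (V \<bullet> outer3 w u z)) (at 0)"
    by (auto intro!: derivative_eq_intros simp: c0 inner_outer3_outer3 u algebra_simps)
  \<comment> \<open>Since \<open>?f\<close> and \<open>?g\<close> agree near 0, the derivative of
    \<open>?f\<close> is also that of \<open>?g\<close>; uniqueness then equates the two
    formulas.\<close>
  have "(?g has_real_derivative
      (w \<bullet> w)\<^sup>2 * (V \<bullet> outer3 x y z)
      + 2 * (w \<bullet> w) * (V \<bullet> outer3 w u u) * ((w \<bullet> x) * (u \<bullet> y) * (u \<bullet> z))) (at 0)"
    by (rule has_field_derivative_transform_within_open[OF f', of "{-e<..<e}"]) (use e fg in auto)
  from DERIV_unique[OF this g'] show ?thesis
    by (simp add: algebra_simps power2_eq_square)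
qed

section \<open>Stationarity as a pair of vector equations\<close>

lemma is_stationary_point_iff_orthogonal:
  assumes "GDERIV f p :> G"
  shows "is_stationary_point M f p \<longleftrightarrow>
    p \<in> M \<and> 0 \<in> tangent_space M p \<and> (\<forall>V\<in>tangent_space M p. G \<bullet> V = 0)"
proof -
  have "G' = G" if "GDERIV f p :> G'" for G'
    using has_derivative_unique[OF that[unfolded gderiv_def] assms[unfolded gderiv_def]]
    by (metis inner_commute vector_eq_rdot)
  then have "GDERIV f p :> G' \<longleftrightarrow> G' = G" for G'
    using assms by blast
  \<comment> \<open>The clause on \<open>0\<close> comes from the demand that a projection lie in
    the set projected onto.\<close>
  then show ?thesis
    by (simp add: is_stationary_point_def has_riemannian_gradient_def
        is_orthogonal_projection_def orthogonal_def)
qed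

text \<open>Each summand of the gradient is symmetric in its last two factors, so pairing it with
  \<open>w \<circ> v \<circ> u\<close> or with \<open>w \<circ> u \<circ> v\<close> gives the same
  vector \<open>S2\<close>. The three families of tangent vectors thus yield two equations.\<close>

lemma is_stationary_point_F0_iff:
  fixes X :: "real ^ 'n ^ 'm" and Y :: "real ^ 'n ^ 'k"
  assumes w: "w \<noteq> 0" and u: "u \<bullet> u = 1"
  defines "x \<equiv> \<lambda>i. column i X" and "y \<equiv> \<lambda>i. column i Y"
  shows "is_stationary_point rank_one_tensors (F0 X Y) (outer3 w u u) \<longleftrightarrow>
    (\<Sum>i\<in>UNIV. (x i \<bullet> u) ^ 4) *\<^sub>R w = (\<Sum>i\<in>UNIV. (x i \<bullet> u)\<^sup>2 *\<^sub>R y i) \<and>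
    (w \<bullet> w) *\<^sub>R (\<Sum>i\<in>UNIV. (x i \<bullet> u) ^ 3 *\<^sub>R x i) = (\<Sum>i\<in>UNIV. ((w \<bullet> y i) * (x i \<bullet> u)) *\<^sub>R x i)"
    (is "?stat \<longleftrightarrow> ?eq1 \<and> ?eq2")
proof -
  define p where "p = outer3 w u u"
  define r where "r i = (x i \<bullet> u)\<^sup>2 *\<^sub>R w - y i" for i
  define G where "G = (\<Sum>i\<in>UNIV. outer3 (r i) (x i) (x i))"
  define S1 where "S1 = (\<Sum>i\<in>UNIV. (x i \<bullet> u)\<^sup>2 *\<^sub>R r i)"
  define S2 where "S2 = (\<Sum>i\<in>UNIV. ((w \<bullet> r i) * (x i \<bullet> u)) *\<^sub>R x i)"
  have "column i (A - B) = column i A - column i B" for i and A B :: "real ^ 'n ^ 'k"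
    by (simp add: column_def vec_eq_iff)
  then have grad: "GDERIV (F0 X Y) p :> G"
    using GDERIV_F0[of X Y p]
    by (simp add: G_def p_def column_tensor3_apply_matrix_outer3 x_def y_def r_def)
  have pM: "p \<in> rank_one_tensors"
    using w u by (auto simp: p_def rank_one_tensors_def outer3_eq_0_iff)
  have S1: "S1 = 0 \<longleftrightarrow> ?eq1"
    by (simp add: S1_def r_def algebra_simps sum_subtractf scaleR_sum_left power2_eq_square
        power4_eq_xxxx)
  have S2: "S2 = 0 \<longleftrightarrow> ?eq2"
    by (simp add: S2_def r_def algebra_simps sum_subtractf scaleR_sum_right power2_eq_square
        power3_eq_cube)
  have G1: "G \<bullet> outer3 v u u = S1 \<bullet> v" for v
    by (simp add: G_def S1_def inner_sum_left inner_outer3_outer3 power2_eq_square mult_ac)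
  have G2: "G \<bullet> outer3 w v u = S2 \<bullet> v" for v
    by (simp add: G_def S2_def inner_sum_left inner_outer3_outer3) (simp add: inner_commute mult_ac)
  \<comment> \<open>Adding a multiple of such a \<open>V\<close> to \<open>p\<close> changes a
    single factor, so the sum is again an outer product.\<close>
  have T1: "outer3 v u u \<in> tangent_space rank_one_tensors p" for v
    by (rule mem_tangent_space_rank_one_tensors[OF pM])
      (metis p_def outer3_add1 outer3_scale1)
  have T2: "outer3 w v u \<in> tangent_space rank_one_tensors p" for v
    by (rule mem_tangent_space_rank_one_tensors[OF pM])
      (metis p_def outer3_add2 outer3_scale2)
  have T0: "0 \<in> tangent_space rank_one_tensors p"
    using T1[of 0] by (simp add: outer3_eq_0_iff[THEN iffD2])
  have "(\<forall>V\<in>tangent_space rank_one_tensors p. G \<bullet> V = 0) \<longleftrightarrow> S1 = 0 \<and> S2 = 0"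
  proof (intro iffI conjI ballI)
    assume "\<forall>V\<in>tangent_space rank_one_tensors p. G \<bullet> V = 0"
    \<comment> \<open>The tangent vectors \<open>outer3 S1 u u\<close> and
      \<open>outer3 w S2 u\<close> serve as tests.\<close>
    then have "S1 \<bullet> S1 = 0" and "S2 \<bullet> S2 = 0"
      using G1 T1 G2 T2 by metis+
    then show "S1 = 0" and "S2 = 0" by simp_all
  next
    fix V assume S: "S1 = 0 \<and> S2 = 0" and V: "V \<in> tangent_space rank_one_tensors p"
    \<comment> \<open>Expanding \<open>G \<bullet> V\<close> by
      \<open>inner_outer3_tangent_space\<close> leaves four sums \<open>s1\<close> to
      \<open>s4\<close>; each is linear in \<open>S1\<close> or \<open>S2\<close>, hence
      zero.\<close>
    have s1: "(\<Sum>i\<in>UNIV. (V \<bullet> outer3 (r i) u u) * (u \<bullet> x i) * (u \<bullet> x i)) = 0"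
    proof -
      have "(\<Sum>i\<in>UNIV. (V \<bullet> outer3 (r i) u u) * (u \<bullet> x i) * (u \<bullet> x i)) = V \<bullet> outer3 S1 u u"
        by (simp add: S1_def linear_sum[OF linear_outer3_1] outer3_scale1 inner_sum_right
            power2_eq_square inner_commute mult_ac)
      then show ?thesis using S by (simp add: outer3_eq_0_iff[THEN iffD2])
    qed
    have s2: "(\<Sum>i\<in>UNIV. (w \<bullet> r i) * (V \<bullet> outer3 w (x i) u) * (u \<bullet> x i)) = 0"
    proof -
      have "(\<Sum>i\<in>UNIV. (w \<bullet> r i) * (V \<bullet> outer3 w (x i) u) * (u \<bullet> x i)) = V \<bullet> outer3 w S2 u"
        by (simp add: S2_def linear_sum[OF linear_outer3_2] outer3_scale2 inner_sum_right
            inner_commute mult_ac)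
      then show ?thesis using S by (simp add: outer3_eq_0_iff[THEN iffD2])
    qed
    have s3: "(\<Sum>i\<in>UNIV. (w \<bullet> r i) * (u \<bullet> x i) * (V \<bullet> outer3 w u (x i))) = 0"
    proof -
      have "(\<Sum>i\<in>UNIV. (w \<bullet> r i) * (u \<bullet> x i) * (V \<bullet> outer3 w u (x i))) = V \<bullet> outer3 w u S2"
        by (simp add: S2_def linear_sum[OF linear_outer3_3] outer3_scale3 inner_sum_right
            inner_commute mult_ac)
      then show ?thesis using S by (simp add: outer3_eq_0_iff[THEN iffD2])
    qed
    have s4: "(\<Sum>i\<in>UNIV. (w \<bullet> r i) * (u \<bullet> x i) * (u \<bullet> x i)) = 0"
    proof -
      have "(\<Sum>i\<in>UNIV. (w \<bullet> r i) * (u \<bullet> x i) * (u \<bullet> x i)) = S2 \<bullet> u"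
        by (simp add: S2_def inner_sum_left) (simp add: inner_commute mult_ac)
      then show ?thesis using S by simp
    qed
    have "(w \<bullet> w)\<^sup>2 * (G \<bullet> V) = (\<Sum>i\<in>UNIV. (w \<bullet> w)\<^sup>2 * (V \<bullet> outer3 (r i) (x i) (x i)))"
      by (simp add: G_def inner_sum_left sum_distrib_left) (simp add: inner_commute)
    also have "\<dots> =
        (w \<bullet> w)\<^sup>2 * (\<Sum>i\<in>UNIV. (V \<bullet> outer3 (r i) u u) * (u \<bullet> x i) * (u \<bullet> x i))
      + (w \<bullet> w) * (\<Sum>i\<in>UNIV. (w \<bullet> r i) * (V \<bullet> outer3 w (x i) u) * (u \<bullet> x i))
      + (w \<bullet> w) * (\<Sum>i\<in>UNIV. (w \<bullet> r i) * (u \<bullet> x i) * (V \<bullet> outer3 w u (x i)))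
      - 2 * (w \<bullet> w) * (V \<bullet> outer3 w u u) * (\<Sum>i\<in>UNIV. (w \<bullet> r i) * (u \<bullet> x i) * (u \<bullet> x i))"
      by (simp only: inner_outer3_tangent_space[OF V[unfolded p_def] u, of "r i" "x i" "x i" for i]
          sum.distrib sum_subtractf sum_distrib_left mult.assoc)
    also have "\<dots> = 0" by (simp add: s1 s2 s3 s4)
    finally show "G \<bullet> V = 0" using w by simp
  qed
  then show ?thesis
    using is_stationary_point_iff_orthogonal[OF grad] pM T0 S1 S2 by (auto simp: p_def)
qed

section \<open>The tensors of the pencil applied to a vector\<close>

lemma tensor4_apply_Z_XX:
  fixes X :: "real ^ 'n ^ 'm"
  shows "tensor4_apply (Z_XX X) u = (\<Sum>i\<in>UNIV. (column i X \<bullet> u) ^ 3 *\<^sub>R column i X)"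
proof -
  have "(\<Sum>b\<in>UNIV. \<Sum>c\<in>UNIV. \<Sum>d\<in>UNIV.
          (\<Sum>i\<in>UNIV. X $ a $ i * X $ b $ i * X $ c $ i * X $ d $ i) * u $ b * u $ c * u $ d)
      = (\<Sum>i\<in>UNIV. (column i X \<bullet> u) ^ 3 * X $ a $ i)" for a
  proof -
    have "(\<Sum>b\<in>UNIV. \<Sum>c\<in>UNIV. \<Sum>d\<in>UNIV.
          (\<Sum>i\<in>UNIV. X $ a $ i * X $ b $ i * X $ c $ i * X $ d $ i) * u $ b * u $ c * u $ d)
      = (\<Sum>b\<in>UNIV. \<Sum>c\<in>UNIV. \<Sum>d\<in>UNIV. \<Sum>i\<in>UNIV.
          X $ a $ i * ((X $ b $ i * u $ b) * ((X $ c $ i * u $ c) * (X $ d $ i * u $ d))))"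
      by (simp add: sum_distrib_left sum_distrib_right mult_ac)
    also have "\<dots> = (\<Sum>i\<in>UNIV. \<Sum>b\<in>UNIV. \<Sum>c\<in>UNIV. \<Sum>d\<in>UNIV.
          X $ a $ i * ((X $ b $ i * u $ b) * ((X $ c $ i * u $ c) * (X $ d $ i * u $ d))))"
      \<comment> \<open>The instantiation orients the swap: the sum over samples only moves outward,
        so the rewriting terminates.\<close>
      by (simp only: sum.swap[of _ "UNIV :: 'n set" "UNIV :: 'm set"])
    also have "\<dots> = (\<Sum>i\<in>UNIV. (column i X \<bullet> u) ^ 3 * X $ a $ i)"
      by (simp only: sum_distrib_left[symmetric] sum_distrib_right[symmetric])
        (simp add: inner_vec_def column_def power3_eq_cube mult_ac)
    finally show ?thesis .
  qed
  then show ?thesis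
    by (simp add: vec_eq_iff tensor4_apply_def Z_XX_def) (simp add: column_def)
qed

text \<open>\<open>Z_XY\<close> is \<open>T_XY\<close> multiplied with itself along the first index.
  Contracting one copy twice with \<open>u\<close> gives \<open>t u\<close> (fact
  \<open>Tuu\<close>); the other copy is then contracted with \<open>t u\<close> in its first index
  and \<open>u\<close> in its last.\<close>

lemma tensor4_apply_Z_XY:
  fixes X :: "real ^ 'n ^ 'm" and Y :: "real ^ 'n ^ 'k"
  defines "t u \<equiv> (\<Sum>i\<in>UNIV. (column i X \<bullet> u)\<^sup>2 *\<^sub>R column i Y)"
  shows "tensor4_apply (Z_XY X Y) u
    = (\<Sum>i\<in>UNIV. ((t u \<bullet> column i Y) * (column i X \<bullet> u)) *\<^sub>R column i X)"
proof -
  let ?T = "T_XY X Y"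
  have Tu: "(\<Sum>b\<in>UNIV. ?T $ l $ a $ b * u $ b) = (\<Sum>i\<in>UNIV. Y $ l $ i * (column i X \<bullet> u) * X $ a $ i)"
    for l a
  proof -
    have "(\<Sum>b\<in>UNIV. ?T $ l $ a $ b * u $ b)
        = (\<Sum>b\<in>UNIV. \<Sum>i\<in>UNIV. Y $ l $ i * (X $ b $ i * u $ b) * X $ a $ i)"
      by (simp add: T_XY_def sum_distrib_left sum_distrib_right mult_ac)
    also have "\<dots> = (\<Sum>i\<in>UNIV. \<Sum>b\<in>UNIV. Y $ l $ i * (X $ b $ i * u $ b) * X $ a $ i)"
      by (rule sum.swap)
    finally show ?thesis
      by (simp add: sum_distrib_left[symmetric] sum_distrib_right[symmetric] inner_vec_def column_def)
  qed
  have Tuu: "(\<Sum>c\<in>UNIV. (\<Sum>d\<in>UNIV. ?T $ l $ c $ d * u $ d) * u $ c) = t u $ l" for l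
  proof -
    have "(\<Sum>c\<in>UNIV. (\<Sum>d\<in>UNIV. ?T $ l $ c $ d * u $ d) * u $ c)
        = (\<Sum>c\<in>UNIV. \<Sum>i\<in>UNIV. Y $ l $ i * (column i X \<bullet> u) * (X $ c $ i * u $ c))"
      by (simp add: Tu) (simp add: sum_distrib_left sum_distrib_right mult_ac)
    also have "\<dots> = (\<Sum>i\<in>UNIV. \<Sum>c\<in>UNIV. Y $ l $ i * (column i X \<bullet> u) * (X $ c $ i * u $ c))"
      by (rule sum.swap)
    also have "\<dots> = (\<Sum>i\<in>UNIV. Y $ l $ i * (column i X \<bullet> u) * (column i X \<bullet> u))"
      by (simp add: sum_distrib_left[symmetric] inner_vec_def column_def)
    finally show ?thesis
      by (simp add: t_def power2_eq_square mult_ac) (simp add: column_def mult_ac)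
  qed
  have "tensor4_apply (Z_XY X Y) u $ a
      = (\<Sum>i\<in>UNIV. (t u \<bullet> column i Y) * (column i X \<bullet> u) * X $ a $ i)" for a
  proof -
    have "tensor4_apply (Z_XY X Y) u $ a = (\<Sum>b\<in>UNIV. \<Sum>c\<in>UNIV. \<Sum>d\<in>UNIV. \<Sum>l\<in>UNIV.
        (?T $ l $ a $ b * u $ b) * (?T $ l $ c $ d * u $ d * u $ c))"
      by (simp add: tensor4_apply_def Z_XY_def sum_distrib_left sum_distrib_right mult_ac)
    also have "\<dots> = (\<Sum>b\<in>UNIV. \<Sum>c\<in>UNIV. \<Sum>l\<in>UNIV. \<Sum>d\<in>UNIV.
        (?T $ l $ a $ b * u $ b) * (?T $ l $ c $ d * u $ d * u $ c))"
      by (intro sum.cong refl, rule sum.swap)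
    also have "\<dots> = (\<Sum>b\<in>UNIV. \<Sum>l\<in>UNIV. \<Sum>c\<in>UNIV. \<Sum>d\<in>UNIV.
        (?T $ l $ a $ b * u $ b) * (?T $ l $ c $ d * u $ d * u $ c))"
      by (intro sum.cong refl, rule sum.swap)
    also have "\<dots> = (\<Sum>l\<in>UNIV. \<Sum>b\<in>UNIV. \<Sum>c\<in>UNIV. \<Sum>d\<in>UNIV.
        (?T $ l $ a $ b * u $ b) * (?T $ l $ c $ d * u $ d * u $ c))"
      by (rule sum.swap)
    also have "\<dots> = (\<Sum>l\<in>UNIV. (\<Sum>b\<in>UNIV. ?T $ l $ a $ b * u $ b) * t u $ l)"
      by (simp only: sum_distrib_left[symmetric] sum_distrib_right[symmetric] Tuu)
    also have "\<dots> = (\<Sum>l\<in>UNIV. \<Sum>i\<in>UNIV. t u $ l * Y $ l $ i * ((column i X \<bullet> u) * X $ a $ i))"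
      by (simp add: Tu) (simp add: sum_distrib_left sum_distrib_right mult_ac)
    also have "\<dots> = (\<Sum>i\<in>UNIV. \<Sum>l\<in>UNIV. t u $ l * Y $ l $ i * ((column i X \<bullet> u) * X $ a $ i))"
      by (rule sum.swap)
    also have "\<dots> = (\<Sum>i\<in>UNIV. (t u \<bullet> column i Y) * (column i X \<bullet> u) * X $ a $ i)"
      by (simp only: sum_distrib_right[symmetric]) (simp add: inner_vec_def column_def mult_ac)
    finally show ?thesis .
  qed
  then show ?thesis
    by (simp add: vec_eq_iff) (simp add: column_def)
qed

section \<open>Stationary points and B-eigenpairs\<close>

theorem theorem19:
  fixes X :: "real ^ 'n ^ 'm" and Y :: "real ^ 'n ^ 'k"
  shows "(\<forall>(U\<^sub>1 :: real ^ 'k ^ 'k) (c :: real ^ 'k) (u :: real ^ 'm).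
            orthogonal_matrix U\<^sub>1 \<longrightarrow> norm u = 1 \<longrightarrow>
            outer3 (U\<^sub>1 *v c) u u \<in> rank_one_tensors \<longrightarrow>
            is_stationary_point rank_one_tensors (F0 X Y) (outer3 (U\<^sub>1 *v c) u u) \<longrightarrow>
            (\<exists>\<gamma>. is_B_eigenpair (Z_XX X) (Z_XY X Y) \<gamma> u))
       \<and> (\<forall>\<gamma> (u :: real ^ 'm).
            is_B_eigenpair (Z_XX X) (Z_XY X Y) \<gamma> u \<longrightarrow>
            (\<exists>(U\<^sub>1 :: real ^ 'k ^ 'k) (c :: real ^ 'k).
               orthogonal_matrix U\<^sub>1 \<and>
               outer3 (U\<^sub>1 *v c) u u \<in> rank_one_tensors \<and>
               is_stationary_point rank_one_tensors (F0 X Y) (outer3 (U\<^sub>1 *v c) u u)))"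
proof -
  define x where "x i = column i X" for i
  define y where "y i = column i Y" for i
  define \<sigma> where "\<sigma> u = (\<Sum>i\<in>UNIV. (x i \<bullet> u) ^ 4)" for u
  define t where "t u = (\<Sum>i\<in>UNIV. (x i \<bullet> u)\<^sup>2 *\<^sub>R y i)" for u
  \<comment> \<open>\<open>N w u\<close> is \<open>T_XY X Y\<close> contracted with \<open>w\<close>
    in its first and \<open>u\<close> in its last index, so \<open>N (t u) u\<close> is
    \<open>Z_XY X Y\<close> applied to \<open>u\<close>.\<close>
  define N where "N w u = (\<Sum>i\<in>UNIV. ((w \<bullet> y i) * (x i \<bullet> u)) *\<^sub>R x i)" for w u
  define Zx where "Zx = tensor4_apply (Z_XX X)"
  define Zy where "Zy = tensor4_apply (Z_XY X Y)"
  have Zx: "Zx u = (\<Sum>i\<in>UNIV. (x i \<bullet> u) ^ 3 *\<^sub>R x i)" for u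
    by (simp add: Zx_def tensor4_apply_Z_XX x_def)
  have Zy: "Zy u = N (t u) u" for u
    by (simp add: Zy_def tensor4_apply_Z_XY x_def y_def t_def N_def)
  have N_scale: "N (r *\<^sub>R w) u = r *\<^sub>R N w u" for r w u
    by (simp add: N_def scaleR_sum_right mult_ac)
  have stat: "is_stationary_point rank_one_tensors (F0 X Y) (outer3 w u u) \<longleftrightarrow>
      \<sigma> u *\<^sub>R w = t u \<and> (w \<bullet> w) *\<^sub>R Zx u = N w u" if "w \<noteq> 0" "u \<bullet> u = 1" for w u
    using is_stationary_point_F0_iff[OF that, of X Y]
    by (simp add: \<sigma>_def t_def Zx N_def x_def y_def)
  have \<sigma>0: "x i \<bullet> u = 0" if "\<sigma> u = 0" for i u
    using that by (simp add: \<sigma>_def sum_nonneg_eq_0_iff)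
  have \<sigma>Zx: "Zx u \<bullet> u = \<sigma> u" for u
    by (simp add: Zx \<sigma>_def inner_sum_left power3_eq_cube power4_eq_xxxx mult_ac)
  have eig: "is_B_eigenpair (Z_XX X) (Z_XY X Y) \<gamma> u \<longleftrightarrow> Zx u = \<gamma> *\<^sub>R Zy u \<and> u \<bullet> u = 1" for \<gamma> u
    by (simp add: is_B_eigenpair_def Zx_def Zy_def)
  have part1: "\<exists>\<gamma>. is_B_eigenpair (Z_XX X) (Z_XY X Y) \<gamma> u"
    if u: "u \<bullet> u = 1" and w: "w \<noteq> 0"
      and st: "is_stationary_point rank_one_tensors (F0 X Y) (outer3 w u u)" for w u
  proof (cases "\<sigma> u = 0")
    case True
    then have "Zx u = 0" by (simp add: Zx \<sigma>0)
    then show ?thesis using u by (auto simp: eig intro!: exI[of _ 0])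
  next
    case False
    from st have 1: "\<sigma> u *\<^sub>R w = t u" and 2: "(w \<bullet> w) *\<^sub>R Zx u = N w u"
      by (simp_all add: stat[OF w u])
    \<comment> \<open>As \<open>t u\<close> is a multiple of \<open>w\<close> and \<open>N\<close>
      is homogeneous in its first argument, the second equation applies to
      \<open>N (t u) u\<close>.\<close>
    have "Zy u = (\<sigma> u * (w \<bullet> w)) *\<^sub>R Zx u"
      by (simp add: Zy 1[symmetric] N_scale 2[symmetric])
    then have "Zx u = inverse (\<sigma> u * (w \<bullet> w)) *\<^sub>R Zy u"
      using False w by (simp del: inverse_mult_distrib)
    then show ?thesis using u by (auto simp: eig)
  qed
  have part2: "\<exists>w. w \<noteq> 0 \<and> is_stationary_point rank_one_tensors (F0 X Y) (outer3 w u u)"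
    if "is_B_eigenpair (Z_XX X) (Z_XY X Y) \<gamma> u" for \<gamma> u
  proof -
    from that have Z: "Zx u = \<gamma> *\<^sub>R Zy u" and u: "u \<bullet> u = 1" by (simp_all add: eig)
    show ?thesis
    proof (cases "\<sigma> u = 0")
      case True
      \<comment> \<open>All \<open>x i\<close> are orthogonal to \<open>u\<close>, so both
        stationarity equations read 0 = 0 and any nonzero \<open>w\<close> serves; a coordinate
        vector at an arbitrary index is taken.\<close>
      obtain w :: "real ^ 'k" where w: "w \<noteq> 0"
        using that[of "axis undefined 1"] by (simp add: axis_eq_0_iff)
      have "is_stationary_point rank_one_tensors (F0 X Y) (outer3 w u u)"
        unfolding stat[OF w u] by (simp add: True t_def Zx N_def \<sigma>0)
      then show ?thesis using w by blast
    next
      case False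
      \<comment> \<open>Pairing the eigenpair equation with \<open>u\<close> relates \<sigma> to
        \<gamma> and shows that \<open>t u\<close> is nonzero.\<close>
      have "N (t u) u \<bullet> u = t u \<bullet> t u"
        by (simp add: N_def t_def inner_sum_left inner_sum_right power2_eq_square mult_ac)
      then have \<gamma>: "\<sigma> u = \<gamma> * (t u \<bullet> t u)"
        using \<sigma>Zx[of u] by (simp add: Z Zy)
      \<comment> \<open>The first stationarity equation forces this choice.\<close>
      define w where "w = inverse (\<sigma> u) *\<^sub>R t u"
      have w: "w \<noteq> 0" using False \<gamma> by (auto simp: w_def)
      \<comment> \<open>By the eigenpair equation the second stationarity equation reduces to this
        scalar identity.\<close>
      have "(w \<bullet> w) * \<gamma> = inverse (\<sigma> u) * inverse (\<sigma> u) * (\<gamma> * (t u \<bullet> t u))"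
        by (simp add: w_def mult_ac)
      also have "\<dots> = inverse (\<sigma> u)" unfolding \<gamma>[symmetric] using False by simp
      finally have ww: "(w \<bullet> w) * \<gamma> = inverse (\<sigma> u)" .
      have "N w u = inverse (\<sigma> u) *\<^sub>R Zy u" by (simp add: w_def N_scale Zy)
      also have "\<dots> = (w \<bullet> w) *\<^sub>R Zx u" by (simp add: Z ww)
      finally have "N w u = (w \<bullet> w) *\<^sub>R Zx u" .
      moreover have "\<sigma> u *\<^sub>R w = t u" using False by (simp add: w_def)
      ultimately have "is_stationary_point rank_one_tensors (F0 X Y) (outer3 w u u)"
        by (simp add: stat[OF w u])
      then show ?thesis using w by blast
    qed
  qed
  show ?thesis
  proof (intro conjI allI impI)
    fix U :: "real ^ 'k ^ 'k" and c :: "real ^ 'k" and u :: "real ^ 'm"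
    assume "norm u = 1" and "outer3 (U *v c) u u \<in> rank_one_tensors"
      and st: "is_stationary_point rank_one_tensors (F0 X Y) (outer3 (U *v c) u u)"
    then have "u \<bullet> u = 1" and "U *v c \<noteq> 0"
      by (auto simp: norm_eq_1 rank_one_tensors_def outer3_eq_0_iff)
    then show "\<exists>\<gamma>. is_B_eigenpair (Z_XX X) (Z_XY X Y) \<gamma> u"
      using part1 st by blast
  next
    fix \<gamma> and u :: "real ^ 'm"
    assume "is_B_eigenpair (Z_XX X) (Z_XY X Y) \<gamma> u"
    then obtain w where "is_stationary_point rank_one_tensors (F0 X Y) (outer3 w u u)"
      using part2 by blast
    \<comment> \<open>The identity matrix with \<open>c = w\<close> represents the first
      factor.\<close>
    then show "\<exists>(U :: real ^ 'k ^ 'k) (c :: real ^ 'k). orthogonal_matrix U \<and>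
        outer3 (U *v c) u u \<in> rank_one_tensors \<and>
        is_stationary_point rank_one_tensors (F0 X Y) (outer3 (U *v c) u u)"
      by (intro exI[of _ "mat 1"] exI[of _ w])
        (simp add: orthogonal_matrix_id is_stationary_point_def)
  qed
qed

end
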